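(* Let $\sigma\ge 0$ be an integer. For all angles $\theta_1,\ldots,\theta_\sigma\in(0,\pi]$ there exist radii $r_1,\ldots,r_\sigma>0$ such that the monic polynomial $$f(x)=\prod_{\substack{1\le i\le\sigma\\ \theta_i\ne\pi}}\left(x^2-2r_i\cos(\theta_i)\,x+r_i^2\right)\cdot\prod_{\substack{1\le i\le\sigma\\ \theta_i=\pi}}(x+r_i)$$ satisfies $$\operatorname{opt}(f)=b(f),\qquad\text{where } b(f)=\sum_{\substack{1\le i\le\sigma\\ \theta_i\neq\pi}}\left(\left\lceil\frac{\pi}{\theta_i}\right\rceil-2\right).$$
   Context: For a monic $f\in\mathbb{R}[x]$ with $f(x)>0$ for all real $x\ge 0$, the optimal degree of a Poincaré multiplier is $$\operatorname{opt}(f)=\min\{\deg g : g\in\mathbb{R}[x]\setminus\{0\},\ \text{all coefficients of } gf \text{ are } \ge 0\}.$$ (By a classical theorem of Poincaré this set is nonempty.) The angles $\theta_i$ need not be distinct. The roots of $f$ are $r_ie^{\pm i\theta_i}$, where an angle $\theta_i=\pi$ corresponds to a single negative real root $-r_i$. *)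

theory Defs
  imports Complex_Main "HOL-Computational_Algebra.Polynomial"
begin

text \<open>
  The optimal degree of a Poincare multiplier. It is meant for monic f with f(x) > 0 for all
  real x \<ge> 0: by Poincare's theorem some multiplier then exists, so LEAST is the minimum.
\<close>

definition opt :: "real poly \<Rightarrow> nat" where
  "opt f = (LEAST d. \<exists>g. g \<noteq> 0 \<and> degree g = d \<and> (\<forall>k. coeff (g * f) k \<ge> 0))"

text \<open>
  An angle \<theta> i \<noteq> \<pi> contributes the conjugate pair of roots r i * exp (\<plusminus> \<i> \<theta> i); an angle
  \<theta> i = \<pi> contributes one negative root - r i. Coefficient lists start with the constant term.
\<close>

definition angle_poly :: "nat \<Rightarrow> (nat \<Rightarrow> real) \<Rightarrow> (nat \<Rightarrow> real) \<Rightarrow> real poly" where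
  "angle_poly \<sigma> \<theta> r =
     (\<Prod>i\<in>{i \<in> {1..\<sigma>}. \<theta> i \<noteq> pi}. [:(r i)\<^sup>2, - 2 * r i * cos (\<theta> i), 1:]) *
     (\<Prod>i\<in>{i \<in> {1..\<sigma>}. \<theta> i = pi}. [:r i, 1:])"

text \<open>
  The number b(f) depends only on the angles. Each summand is a nonnegative integer when
  0 < \<theta> i < \<pi>; the type int avoids truncated subtraction.
\<close>

definition angle_bound :: "nat \<Rightarrow> (nat \<Rightarrow> real) \<Rightarrow> int" where
  "angle_bound \<sigma> \<theta> = (\<Sum>i\<in>{i \<in> {1..\<sigma>}. \<theta> i \<noteq> pi}. (\<lceil>pi / \<theta> i\<rceil> - 2))"

end

theory Submission
  imports Defs
begin

text \<open>
  Write \<open>L i = \<lceil>\<pi> / \<theta> i\<rceil>\<close>. The polynomial \<open>f\<close> is a product of factors, one for each angle; the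
  factor of angle \<open>\<theta> i\<close> has degree 2, or 1 when \<open>\<theta> i = \<pi>\<close>.

  Upper bound. A factor with angle \<open>\<theta> < \<pi>\<close> has a multiplier of degree \<open>L - 2\<close>, with coefficients
  \<open>sin ((k + 1) \<theta>) / r\<^sup>k\<close> (\<open>quadratic_multiplier\<close>), and the coefficients of a linear factor are
  positive already. Multiplying these together gives degree \<open>b(f)\<close>, whatever the radii are.

  Lower bound. By duality it is enough to find a sequence \<open>s\<close> that is orthogonal to every
  multiple of \<open>f\<close> and is positive at the indices below \<open>\<Sum>i. L i\<close>, which is \<open>deg f + b(f)\<close>: a nonzero
  multiple of \<open>f\<close> with nonnegative coefficients and degree below this number would have a positive
  pairing with \<open>s\<close>. The sequences \<open>r\<^sup>k sin (k \<theta> + \<beta>)\<close> are orthogonal to the multiples of the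
  factor with root \<open>r exp (\<i> \<theta>)\<close>, and a suitable phase makes such a sequence positive on any
  chosen window of \<open>L\<close> consecutive indices. If the radii grow fast enough, then a weighted sum of
  such sequences, one per angle, is dominated by its \<open>i\<close>-th summand on the \<open>i\<close>-th of consecutive windows
  of lengths \<open>L 1, L 2, \<dots>\<close>, so that the windows together fill the required range
  (\<open>positive_annihilator_exists\<close>).
\<close>

section \<open>Sequences as functionals on polynomials\<close>

definition pairing :: "(nat \<Rightarrow> real) \<Rightarrow> real poly \<Rightarrow> real" where
  "pairing s p = (\<Sum>k\<le>degree p. coeff p k * s k)"

lemma pairing_eq_sum: "degree p \<le> n \<Longrightarrow> pairing s p = (\<Sum>k\<le>n. coeff p k * s k)"
  unfolding pairing_def by (rule sum.mono_neutral_left) (auto simp: coeff_eq_0)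

lemma pairing_0 [simp]: "pairing s 0 = 0"
  by (simp add: pairing_def)

lemma pairing_add: "pairing s (p + q) = pairing s p + pairing s q"
proof -
  define n where "n = max (degree p) (degree q)"
  have "degree p \<le> n" "degree q \<le> n" "degree (p + q) \<le> n"
    by (auto simp: n_def degree_add_le_max)
  then show ?thesis by (simp add: pairing_eq_sum sum.distrib algebra_simps)
qed

lemma pairing_smult: "pairing s (smult a p) = a * pairing s p"
  by (simp add: pairing_eq_sum[of "smult a p" "degree p"] pairing_eq_sum[of p "degree p"]
      sum_distrib_left mult.assoc degree_smult_le)

lemma pairing_pCons: "pairing s (pCons a p) = a * s 0 + pairing (\<lambda>k. s (Suc k)) p"
  by (simp add: pairing_eq_sum[of "pCons a p" "Suc (degree p)"] pairing_eq_sum[of p "degree p"]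
      degree_pCons_le sum.atMost_Suc_shift del: sum.atMost_Suc)

lemma pairing_add_seq: "pairing (\<lambda>k. s k + t k) p = pairing s p + pairing t p"
  by (simp add: pairing_def sum.distrib algebra_simps)

lemma pairing_scale_seq: "pairing (\<lambda>k. c * s k) p = c * pairing s p"
  by (simp add: pairing_def sum_distrib_left algebra_simps)

lemma pairing_pos:
  assumes "h \<noteq> 0" and "\<And>k. coeff h k \<ge> 0" and "\<And>k. k \<le> degree h \<Longrightarrow> s k > 0"
  shows "pairing s h > 0"
  unfolding pairing_def
proof (rule sum_pos2[of _ "degree h"])
  have "coeff h (degree h) > 0"
    using assms(1) assms(2)[of "degree h"] by (simp add: order_less_le)
  then show "0 < coeff h (degree h) * s (degree h)" using assms(3) by simp
  show "0 \<le> coeff h i * s i" if "i \<in> {..degree h}" for i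
    using that assms(2)[of i] assms(3)[of i] by simp
qed auto

section \<open>The factor of a single angle\<close>

definition angle_factor :: "real \<Rightarrow> real \<Rightarrow> real poly" where
  "angle_factor t r = (if t = pi then [:r, 1:] else [:r\<^sup>2, - 2 * r * cos t, 1:])"

lemma angle_poly_eq_prod: "angle_poly \<sigma> \<theta> r = (\<Prod>i\<in>{1..\<sigma>}. angle_factor (\<theta> i) (r i))"
proof -
  have "(\<Prod>i\<in>{1..\<sigma>}. angle_factor (\<theta> i) (r i)) =
      (\<Prod>i\<in>{1..\<sigma>} \<inter> {i. \<theta> i = pi}. [:r i, 1:]) *
      (\<Prod>i\<in>{1..\<sigma>} \<inter> - {i. \<theta> i = pi}. [:(r i)\<^sup>2, - 2 * r i * cos (\<theta> i), 1:])"
    unfolding angle_factor_def by (rule prod.If_cases) simp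
  moreover have "{1..\<sigma>} \<inter> {i. \<theta> i = pi} = {i \<in> {1..\<sigma>}. \<theta> i = pi}"
    "{1..\<sigma>} \<inter> - {i. \<theta> i = pi} = {i \<in> {1..\<sigma>}. \<theta> i \<noteq> pi}" by auto
  ultimately show ?thesis by (simp only: angle_poly_def mult.commute)
qed

lemma angle_factor_nonzero: "angle_factor t r \<noteq> 0"
  by (simp add: angle_factor_def)

lemma degree_angle_factor: "degree (angle_factor t r) = (if t = pi then 1 else 2)"
  by (simp add: angle_factor_def)

lemma sin_three_term: "sin (x + t) + sin (x - t) = 2 * cos t * sin (x::real)"
  by (simp add: sin_add sin_diff)

text \<open>
  The pairing is the imaginary part of \<open>exp (\<i> \<beta>) h(r exp (\<i> t))\<close>, where \<open>h\<close> is the multiple of the factor,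
  and \<open>r exp (\<i> t)\<close> is a root of the factor. In real terms, shifting the sequence by one index only
  scales it and moves its phase, so it is enough that the sequence is orthogonal to the factor for
  every phase.
\<close>

lemma pairing_oscillation_multiple:
  "pairing (\<lambda>k. r ^ k * sin (real k * t + \<beta>)) (g * angle_factor t r) = 0"
proof (induction g arbitrary: \<beta>)
  case 0
  then show ?case by simp
next
  case (pCons a g)
  have factor: "pairing (\<lambda>k. r ^ k * sin (real k * t + \<beta>)) (angle_factor t r) = 0"
    using arg_cong[OF sin_three_term[of "\<beta> + t" t], of "\<lambda>x. r * (r * x)"]
    by (auto simp: angle_factor_def pairing_pCons power2_eq_square algebra_simps)
  have "(\<lambda>k. r ^ Suc k * sin (real (Suc k) * t + \<beta>)) =
      (\<lambda>k. r * (r ^ k * sin (real k * t + (\<beta> + t))))"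
    by (auto simp: algebra_simps)
  then have "pairing (\<lambda>k. r ^ Suc k * sin (real (Suc k) * t + \<beta>)) (g * angle_factor t r) = 0"
    by (simp only: pairing_scale_seq pCons.IH)
  then show ?case
    by (simp add: mult_pCons_left pairing_add pairing_smult pairing_pCons factor
        del: power_Suc of_nat_Suc)
qed

section \<open>The window of an angle\<close>

definition window :: "real \<Rightarrow> nat" where
  "window t = nat \<lceil>pi / t\<rceil>"

lemma window_bounds:
  assumes "0 < t" "t \<le> pi"
  shows "1 \<le> window t" "(real (window t) - 1) * t < pi" "pi \<le> real (window t) * t"
proof -
  have "pi / t \<ge> 1" using assms by (simp add: field_simps)
  then have c: "\<lceil>pi / t\<rceil> \<ge> 1" by linarith
  then show "1 \<le> window t" unfolding window_def by linarith
  have w: "real (window t) = of_int \<lceil>pi / t\<rceil>" using c by (simp add: window_def)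
  have "real (window t) - 1 < pi / t" "pi / t \<le> real (window t)"
    unfolding w by linarith+
  then show "(real (window t) - 1) * t < pi" "pi \<le> real (window t) * t"
    using assms by (simp_all add: field_simps)
qed

lemma window_ge_2:
  assumes "0 < t" "t < pi"
  shows "2 \<le> window t"
proof -
  have "real (window t) * t \<ge> pi" "1 \<le> window t" using window_bounds[of t] assms by auto
  then show ?thesis using assms by (cases "window t = 1") auto
qed

lemma window_pi [simp]: "window pi = 1"
  by (simp add: window_def)

lemma degree_angle_factor_le_window:
  assumes "0 < t" "t \<le> pi"
  shows "degree (angle_factor t r) \<le> window t"
  using window_ge_2[of t] assms by (auto simp: degree_angle_factor)

lemma positive_phase_exists:
  assumes "0 < t" "t \<le> pi"
  obtains \<alpha> where "\<And>j. j < window t \<Longrightarrow> sin (real j * t + \<alpha>) > 0"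
proof
  fix j assume "j < window t"
  then have "real j * t \<le> (real (window t) - 1) * t"
    using assms by (intro mult_right_mono) auto
  then show "sin (real j * t + (pi - (real (window t) - 1) * t) / 2) > 0"
    using window_bounds(2)[OF assms] assms
    by (intro sin_gt_zero add_nonneg_pos) (auto simp: field_simps)
qed

section \<open>Multipliers of the expected degree\<close>

text \<open>
  The coefficients \<open>sin ((k + 1) t) / r\<^sup>k\<close> satisfy the recurrence belonging to the factor, so all inner
  coefficients of the product cancel. What is left are the two ends: the constant term, and the two
  leading coefficients, which have the signs of \<open>- sin (L t)\<close> and \<open>sin ((L - 1) t)\<close> for
  \<open>L = window t\<close>. They are nonnegative because \<open>(L - 1) t < \<pi> \<le> L t\<close>.
\<close>

lemma quadratic_multiplier:
  assumes t: "0 < t" "t < pi" and r: "r > 0"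
  shows "\<exists>g. g \<noteq> 0 \<and> degree g = window t - 2 \<and> (\<forall>k. coeff (g * angle_factor t r) k \<ge> 0)"
proof -
  define n where "n = window t - 1"
  have L: "window t = Suc n" "n \<ge> 1" using window_ge_2[OF t] by (auto simp: n_def)
  have b: "real n * t < pi" "pi \<le> real (Suc n) * t"
    using window_bounds[of t] t unfolding L by auto
  define c where "c k = sin (real (Suc k) * t) / r ^ k" for k
  define g where "g = (\<Sum>k<n. monom (c k) k)"
  have cg: "coeff g k = (if k < n then c k else 0)" for k
    unfolding g_def by (simp add: coeff_sum if_distrib cong: if_cong)
  have cpos: "c k > 0" if "k < n" for k
  proof -
    have "real (Suc k) * t \<le> real n * t" using that t by (intro mult_right_mono) auto
    then have "real (Suc k) * t < pi" using b by linarith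
    then show ?thesis
      unfolding c_def using t r by (intro divide_pos_pos sin_gt_zero mult_pos_pos) auto
  qed
  have end_sign: "sin (real (Suc n) * t) \<le> 0"
  proof -
    have "real (Suc n) * t - pi \<le> pi" using b t by (simp add: algebra_simps)
    then have "sin (real (Suc n) * t - pi) \<ge> 0" using b by (intro sin_ge_zero) auto
    then show ?thesis by (simp add: sin_diff)
  qed
  have rec: "r\<^sup>2 * c (Suc (Suc k)) - 2 * r * cos t * c (Suc k) + c k = 0" for k
    using sin_three_term[of "real (Suc (Suc k)) * t" t] r
    by (simp add: c_def power2_eq_square field_simps)
  have rec0: "r\<^sup>2 * c (Suc 0) - 2 * r * cos t * c 0 = 0"
    using sin_three_term[of t t] r by (simp add: c_def power2_eq_square field_simps)
  have cn: "c n \<le> 0" unfolding c_def using end_sign r by (simp add: divide_nonpos_pos)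
  have coeffs: "coeff (g * angle_factor t r) k \<ge> 0" for k
  proof -
    have prod: "g * angle_factor t r =
        smult (r\<^sup>2) g + pCons 0 (smult (- 2 * r * cos t) g + pCons 0 g)"
      using t by (simp add: angle_factor_def)
    \<comment> \<open>At positive indices below \<open>n\<close> the recurrence gives zero. At index \<open>n\<close> the product lacks
      the term \<open>r\<^sup>2 c n\<close> of the recurrence, so its coefficient is \<open>- r\<^sup>2 c n\<close>.\<close>
    consider "k = 0" | "k = Suc 0" | j where "k = Suc (Suc j)"
      by (metis nat.exhaust)
    then show ?thesis
    proof cases
      case 1
      then show ?thesis using cpos[of 0] L by (simp add: prod cg)
    next
      case 2
      have "r\<^sup>2 * c (Suc 0) \<le> 0" if "n = 1" using cn that by (simp add: mult_nonneg_nonpos)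
      then show ?thesis using 2 rec0 L by (cases "n = 1") (auto simp: prod cg)
    next
      case 3
      consider "Suc (Suc j) < n" | "Suc (Suc j) = n" | "Suc j = n" | "Suc j > n" by linarith
      then show ?thesis
      proof cases
        case 1
        then show ?thesis using 3 rec[of j] by (simp add: prod cg)
      next
        case 2
        have "r\<^sup>2 * c (Suc (Suc j)) \<le> 0" using cn 2 by (simp add: mult_nonneg_nonpos)
        then show ?thesis using 3 2[symmetric] rec[of j] by (simp add: prod cg)
      next
        case a: 3
        then show ?thesis using 3 a[symmetric] cpos[of j] by (simp add: prod cg)
      next
        case 4
        then show ?thesis using 3 by (simp add: prod cg)
      qed
    qed
  qed
  have top: "coeff g (n - 1) \<noteq> 0" using cpos[of "n - 1"] L by (simp add: cg)
  have "degree g = n - 1"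
    using le_degree[OF top] by (intro antisym degree_le) (auto simp: cg)
  then show ?thesis using coeffs top L by (intro exI[of _ g]) auto
qed

lemma coeff_mult_nonneg:
  fixes p q :: "'a::linordered_idom poly"
  assumes "\<And>k. coeff p k \<ge> 0" "\<And>k. coeff q k \<ge> 0"
  shows "coeff (p * q) k \<ge> 0"
  using assms by (simp add: coeff_mult sum_nonneg)

lemma angle_factor_multiplier:
  assumes t: "0 < t" "t \<le> pi" and r: "r > 0"
  shows "\<exists>g. g \<noteq> 0 \<and> degree g = window t - degree (angle_factor t r) \<and>
    (\<forall>k. coeff (g * angle_factor t r) k \<ge> 0)"
proof (cases "t = pi")
  case True
  have "coeff [:r, 1:] k \<ge> 0" for k using r by (auto simp: coeff_pCons split: nat.split)
  then show ?thesis
    using True by (intro exI[of _ 1]) (simp add: degree_angle_factor angle_factor_def)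
next
  case False
  then show ?thesis using quadratic_multiplier[of t r] assms by (auto simp: degree_angle_factor)
qed

lemma angle_poly_multiplier:
  assumes \<theta>: "\<And>i. i \<in> {1..\<sigma>} \<Longrightarrow> 0 < \<theta> i \<and> \<theta> i \<le> pi" and r: "\<And>i. i \<in> {1..\<sigma>} \<Longrightarrow> r i > 0"
  shows "\<exists>g. g \<noteq> 0 \<and>
    degree g = (\<Sum>i\<in>{1..\<sigma>}. window (\<theta> i) - degree (angle_factor (\<theta> i) (r i))) \<and>
    (\<forall>k. coeff (g * angle_poly \<sigma> \<theta> r) k \<ge> 0)"
proof -
  have "\<forall>i\<in>{1..\<sigma>}. \<exists>g. g \<noteq> 0 \<and>
      degree g = window (\<theta> i) - degree (angle_factor (\<theta> i) (r i)) \<and>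
      (\<forall>k. coeff (g * angle_factor (\<theta> i) (r i)) k \<ge> 0)"
    using angle_factor_multiplier \<theta> r by blast
  then obtain G where G: "\<And>i. i \<in> {1..\<sigma>} \<Longrightarrow> G i \<noteq> 0"
      "\<And>i. i \<in> {1..\<sigma>} \<Longrightarrow> degree (G i) = window (\<theta> i) - degree (angle_factor (\<theta> i) (r i))"
      "\<And>i k. i \<in> {1..\<sigma>} \<Longrightarrow> coeff (G i * angle_factor (\<theta> i) (r i)) k \<ge> 0"
    by metis
  have nonneg: "coeff (\<Prod>i\<in>A. G i * angle_factor (\<theta> i) (r i)) k \<ge> 0"
    if "finite A" "A \<subseteq> {1..\<sigma>}" for A k
    using that
  proof (induction A arbitrary: k rule: finite_induct)
    case empty
    then show ?case by simp
  next
    case (insert i A)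
    then show ?case using G(3) by (simp add: coeff_mult_nonneg)
  qed
  have "coeff ((\<Prod>i\<in>{1..\<sigma>}. G i) * angle_poly \<sigma> \<theta> r) k \<ge> 0" for k
    using nonneg[of "{1..\<sigma>}"] by (simp add: angle_poly_eq_prod prod.distrib)
  moreover have "degree (\<Prod>i\<in>{1..\<sigma>}. G i) = (\<Sum>i\<in>{1..\<sigma>}. degree (G i))"
    using G(1) by (intro degree_prod_eq_sum_degree) auto
  ultimately show ?thesis using G by (intro exI[of _ "\<Prod>i\<in>{1..\<sigma>}. G i"]) auto
qed

section \<open>Positive sequences orthogonal to the multiples\<close>

text \<open>
  The factor \<open>\<rho> R\<^sup>k / R\<^sup>K\<close> of \<open>u k\<close>, with \<open>R = \<rho>\<^sup>2\<close>, is \<open>\<rho>\<^bsup>2 (k - K) + 1\<^esup>\<close>. As \<open>\<rho>\<close> grows, it vanishes for \<open>k < K\<close>, where positivity of \<open>s\<close> is kept, and tends to infinity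
  for \<open>k \<ge> K\<close>, where \<open>u\<close> decides the sign. The leading factor \<open>\<rho>\<close> is what puts the
  threshold strictly between the indices \<open>K - 1\<close> and \<open>K\<close>.
\<close>

lemma extend_positive_window:
  fixes s u :: "nat \<Rightarrow> real"
  assumes s: "\<And>k. k < K \<Longrightarrow> s k > 0" and u: "\<And>k. K \<le> k \<Longrightarrow> k < M \<Longrightarrow> u k > 0"
  shows "\<exists>\<rho>>0. \<forall>k<M. s k + \<rho> / (\<rho>\<^sup>2) ^ K * ((\<rho>\<^sup>2) ^ k * u k) > 0"
proof -
  have "eventually (\<lambda>\<rho>. s k + \<rho> / (\<rho>\<^sup>2) ^ K * ((\<rho>\<^sup>2) ^ k * u k) > 0) at_top" if "k < M" for k
  proof (cases "k < K")
    case True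
    define d where "d = K - Suc k"
    have K: "K = Suc (k + d)" using True by (simp add: d_def)
    have "eventually (\<lambda>\<rho>. \<rho> > max 1 (\<bar>u k\<bar> / s k)) at_top" by (rule eventually_gt_at_top)
    then show ?thesis
    proof eventually_elim
      case (elim \<rho>)
      then have \<rho>: "\<rho> > 1" "\<bar>u k\<bar> < s k * \<rho>" using s[OF True] by (auto simp: field_simps)
      have "\<rho> / (\<rho>\<^sup>2) ^ K * ((\<rho>\<^sup>2) ^ k * u k) = u k / (\<rho> * (\<rho>\<^sup>2) ^ d)"
        using \<rho> by (simp add: K power_add power2_eq_square field_simps)
      moreover have "\<bar>u k / (\<rho> * (\<rho>\<^sup>2) ^ d)\<bar> < s k"
      proof -
        have "\<bar>u k\<bar> < s k * \<rho> * 1" using \<rho> by simp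
        also have "\<dots> \<le> s k * \<rho> * (\<rho>\<^sup>2) ^ d"
          using \<rho> s[OF True] by (intro mult_left_mono one_le_power) auto
        finally show ?thesis using \<rho> by (simp add: abs_mult abs_divide field_simps)
      qed
      ultimately show ?case by linarith
    qed
  next
    case False
    define d where "d = k - K"
    have k: "k = K + d" using False by (simp add: d_def)
    have uk: "u k > 0" using u False that by simp
    have "eventually (\<lambda>\<rho>. \<rho> > max 1 (\<bar>s k\<bar> / u k)) at_top" by (rule eventually_gt_at_top)
    then show ?thesis
    proof eventually_elim
      case (elim \<rho>)
      then have \<rho>: "\<rho> > 1" "\<bar>s k\<bar> < \<rho> * u k" using uk by (auto simp: field_simps)
      have "\<rho> / (\<rho>\<^sup>2) ^ K * ((\<rho>\<^sup>2) ^ k * u k) = \<rho> * u k * (\<rho>\<^sup>2) ^ d"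
        using \<rho> by (simp add: k power_add field_simps)
      moreover have "\<rho> * u k * 1 \<le> \<rho> * u k * (\<rho>\<^sup>2) ^ d"
        using \<rho> uk by (intro mult_left_mono one_le_power) auto
      ultimately show ?case using \<rho> by linarith
    qed
  qed
  then have "eventually (\<lambda>\<rho>. \<forall>k\<in>{..<M}. s k + \<rho> / (\<rho>\<^sup>2) ^ K * ((\<rho>\<^sup>2) ^ k * u k) > 0) at_top"
    by (subst eventually_ball_finite_distrib) auto
  then have "eventually (\<lambda>\<rho>. \<rho> > 0 \<and>
      (\<forall>k\<in>{..<M}. s k + \<rho> / (\<rho>\<^sup>2) ^ K * ((\<rho>\<^sup>2) ^ k * u k) > 0)) at_top"
    using eventually_gt_at_top[of 0] by eventually_elim auto
  from eventually_happens[OF this] show ?thesis by auto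
qed

text \<open>
  Each further angle is given a much larger radius, which prolongs the positive range of the
  sequence by the window of that angle. Both summands of the new sequence are still orthogonal to
  the multiples of the longer product, because either the old product or the new factor divides it.
\<close>

lemma positive_annihilator_exists:
  assumes "\<And>i. i \<in> {1..\<sigma>} \<Longrightarrow> 0 < \<theta> i \<and> \<theta> i \<le> pi"
  shows "\<exists>r s. (\<forall>i\<in>{1..\<sigma>}. r i > 0) \<and> (\<forall>k < (\<Sum>i\<in>{1..\<sigma>}. window (\<theta> i)). s k > 0) \<and>
    (\<forall>g. pairing s (g * angle_poly \<sigma> \<theta> r) = 0)"
  using assms
proof (induction \<sigma>)
  case 0
  then show ?case by (intro exI[of _ "\<lambda>_. 1"] exI[of _ "\<lambda>_. 0"]) (simp add: pairing_def)
next
  case (Suc \<sigma>)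
  have "\<exists>r s. (\<forall>i\<in>{1..\<sigma>}. r i > 0) \<and> (\<forall>k < (\<Sum>i\<in>{1..\<sigma>}. window (\<theta> i)). s k > 0) \<and>
    (\<forall>g. pairing s (g * angle_poly \<sigma> \<theta> r) = 0)"
    using Suc.prems by (intro Suc.IH) auto
  then obtain r s where r: "\<And>i. i \<in> {1..\<sigma>} \<Longrightarrow> r i > 0"
    and s: "\<And>k. k < (\<Sum>i\<in>{1..\<sigma>}. window (\<theta> i)) \<Longrightarrow> s k > 0"
    and ann: "\<And>g. pairing s (g * angle_poly \<sigma> \<theta> r) = 0"
    by blast
  define t where "t = \<theta> (Suc \<sigma>)"
  define K where "K = (\<Sum>i\<in>{1..\<sigma>}. window (\<theta> i))"
  have t: "0 < t" "t \<le> pi" using Suc.prems[of "Suc \<sigma>"] by (auto simp: t_def)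
  obtain \<alpha> where \<alpha>: "\<And>j. j < window t \<Longrightarrow> sin (real j * t + \<alpha>) > 0"
    using positive_phase_exists[OF t] by blast
  \<comment> \<open>The phase is moved so that the new window starts at index \<open>K\<close>.\<close>
  define \<beta> where "\<beta> = \<alpha> - real K * t"
  have "sin (real k * t + \<beta>) > 0" if "K \<le> k" "k < K + window t" for k
    using \<alpha>[of "k - K"] that by (simp add: \<beta>_def of_nat_diff algebra_simps)
  then obtain \<rho> where \<rho>: "\<rho> > 0"
    and pos: "\<And>k. k < K + window t \<Longrightarrow>
      s k + \<rho> / (\<rho>\<^sup>2) ^ K * ((\<rho>\<^sup>2) ^ k * sin (real k * t + \<beta>)) > 0"
    using extend_positive_window[of K s "K + window t" "\<lambda>k. sin (real k * t + \<beta>)"] s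
    unfolding K_def by blast
  define r' where "r' = r(Suc \<sigma> := \<rho>\<^sup>2)"
  define s' where "s' k = s k + \<rho> / (\<rho>\<^sup>2) ^ K * ((\<rho>\<^sup>2) ^ k * sin (real k * t + \<beta>))" for k
  have step: "angle_poly (Suc \<sigma>) \<theta> r' = angle_poly \<sigma> \<theta> r * angle_factor t (\<rho>\<^sup>2)"
    by (simp add: angle_poly_eq_prod r'_def t_def)
  have "pairing s' (g * angle_poly (Suc \<sigma>) \<theta> r') = 0" for g
  proof -
    have "pairing s (g * angle_poly (Suc \<sigma>) \<theta> r') = 0"
      using ann[of "g * angle_factor t (\<rho>\<^sup>2)"] by (simp add: step mult_ac)
    moreover have "pairing (\<lambda>k. (\<rho>\<^sup>2) ^ k * sin (real k * t + \<beta>)) (g * angle_poly (Suc \<sigma>) \<theta> r') = 0"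
      using pairing_oscillation_multiple[of "\<rho>\<^sup>2" t \<beta> "g * angle_poly \<sigma> \<theta> r"]
      by (simp add: step mult_ac)
    ultimately show ?thesis unfolding s'_def by (simp only: pairing_add_seq pairing_scale_seq)
  qed
  moreover have "\<forall>i\<in>{1..Suc \<sigma>}. r' i > 0"
    using r \<rho> by (auto simp: r'_def)
  moreover have "\<forall>k < (\<Sum>i\<in>{1..Suc \<sigma>}. window (\<theta> i)). s' k > 0"
    using pos by (simp add: s'_def K_def t_def)
  ultimately show ?case by blast
qed

section \<open>The optimal degree\<close>

lemma angle_bound_eq_sum:
  assumes "\<And>i. i \<in> {1..\<sigma>} \<Longrightarrow> 0 < \<theta> i \<and> \<theta> i \<le> pi"
  shows "angle_bound \<sigma> \<theta> =
    int (\<Sum>i\<in>{1..\<sigma>}. window (\<theta> i) - degree (angle_factor (\<theta> i) (r i)))"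
proof -
  have "int (window (\<theta> i) - degree (angle_factor (\<theta> i) (r i))) =
      (if \<theta> i \<noteq> pi then \<lceil>pi / \<theta> i\<rceil> - 2 else 0)" if "i \<in> {1..\<sigma>}" for i
    using window_ge_2[of "\<theta> i"] assms[OF that] by (auto simp: degree_angle_factor window_def)
  then have "(\<Sum>i\<in>{1..\<sigma>}. int (window (\<theta> i) - degree (angle_factor (\<theta> i) (r i)))) =
      (\<Sum>i\<in>{1..\<sigma>}. if \<theta> i \<noteq> pi then \<lceil>pi / \<theta> i\<rceil> - 2 else 0)"
    by (intro sum.cong) auto
  then show ?thesis
    unfolding angle_bound_def of_nat_sum by (subst sum.inter_filter) simp_all
qed

theorem theorem2:
  fixes \<sigma> :: nat and \<theta> :: "nat \<Rightarrow> real"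
  assumes "\<And>i. i \<in> {1..\<sigma>} \<Longrightarrow> 0 < \<theta> i \<and> \<theta> i \<le> pi"
  shows "\<exists>r :: nat \<Rightarrow> real. (\<forall>i\<in>{1..\<sigma>}. r i > 0) \<and>
           int (opt (angle_poly \<sigma> \<theta> r)) = angle_bound \<sigma> \<theta>"
proof -
  obtain r s where r: "\<And>i. i \<in> {1..\<sigma>} \<Longrightarrow> r i > 0"
    and s: "\<And>k. k < (\<Sum>i\<in>{1..\<sigma>}. window (\<theta> i)) \<Longrightarrow> s k > 0"
    and ann: "\<And>g. pairing s (g * angle_poly \<sigma> \<theta> r) = 0"
    using positive_annihilator_exists[of \<sigma> \<theta>] assms by blast
  let ?f = "angle_poly \<sigma> \<theta> r"
  define b where "b = (\<Sum>i\<in>{1..\<sigma>}. window (\<theta> i) - degree (angle_factor (\<theta> i) (r i)))"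
  have f0: "?f \<noteq> 0" by (simp add: angle_poly_eq_prod angle_factor_nonzero)
  have "degree ?f = (\<Sum>i\<in>{1..\<sigma>}. degree (angle_factor (\<theta> i) (r i)))"
    unfolding angle_poly_eq_prod
    by (intro degree_prod_eq_sum_degree) (auto simp: angle_factor_nonzero)
  then have total: "b + degree ?f = (\<Sum>i\<in>{1..\<sigma>}. window (\<theta> i))"
    using degree_angle_factor_le_window assms
    by (auto simp: b_def sum.distrib[symmetric] intro!: sum.cong)
  have "opt ?f = b"
    unfolding opt_def
  proof (rule Least_equality)
    show "\<exists>g. g \<noteq> 0 \<and> degree g = b \<and> (\<forall>k. coeff (g * ?f) k \<ge> 0)"
      using angle_poly_multiplier[of \<sigma> \<theta> r] assms r unfolding b_def by blast
  next
    fix d assume "\<exists>g. g \<noteq> 0 \<and> degree g = d \<and> (\<forall>k. coeff (g * ?f) k \<ge> 0)"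
    then obtain g where g: "g \<noteq> 0" "degree g = d" "\<And>k. coeff (g * ?f) k \<ge> 0" by blast
    show "b \<le> d"
    proof (rule ccontr)
      assume "\<not> b \<le> d"
      then have "degree (g * ?f) < (\<Sum>i\<in>{1..\<sigma>}. window (\<theta> i))"
        using g f0 total by (simp add: degree_mult_eq)
      then have "pairing s (g * ?f) > 0"
        using g f0 s by (intro pairing_pos) auto
      then show False using ann[of g] by simp
    qed
  qed
  then have "int (opt ?f) = angle_bound \<sigma> \<theta>"
    using angle_bound_eq_sum[of \<sigma> \<theta> r] assms by (simp add: b_def)
  then show ?thesis using r by blast
qed

end
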